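(* Let $G$ be a simple undirected graph with graph energy $\mathcal{E}(G)$ and Randić index $R(G)$. Then $\mathcal{E}(G)=2R(G)$ if and only if $G$ is a disjoint union of complete bipartite graphs.
   Context: For a simple undirected graph $G=(V,E)$ with vertex set $V=\{v_1,\dots,v_n\}$, let $A\in M_n(\mathbb{R})$ be its adjacency matrix ($A_{ij}=1$ if $v_i$ and $v_j$ are adjacent and $A_{ij}=0$ otherwise), with eigenvalues $\lambda_1,\dots,\lambda_n$ counted with multiplicity. The energy of $G$ is $\mathcal{E}(G)=\sum_{i=1}^n|\lambda_i|$. For a vertex $v$, $\deg(v)$ denotes its degree, i.e. its number of neighbours. The Randić index of $G$ is $R(G)=\sum_{(v,w)\in E}\frac{1}{\sqrt{\deg(v)\deg(w)}}$, where each undirected edge is counted once. A complete bipartite graph $K_{p,q}$ has as vertex set a disjoint union of two sets of sizes $p$ and $q$, with two vertices adjacent exactly when they lie in different sets; the complete bipartite graphs in a disjoint union may have different sizes $p,q$. *)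

theory Defs
  imports
    "Graph_Theory.Graph_Theory"
    "Jordan_Normal_Form.Char_Poly"
    "HOL-Computational_Algebra.Computational_Algebra"
begin

text \<open>
  A finite simple undirected graph is a \<^locale>\<open>pair_graph\<close>: a finite, loop-free,
  symmetric digraph whose arcs are ordered pairs of vertices.  Each undirected edge
  \<open>{u, v}\<close> corresponds to the two arcs \<open>(u, v)\<close> and \<open>(v, u)\<close>.
\<close>

definition vertex_degree :: "'a pair_pre_digraph \<Rightarrow> 'a \<Rightarrow> nat" where
  "vertex_degree G v = card {w \<in> pverts G. (v, w) \<in> parcs G}"

definition undirected_edges :: "'a pair_pre_digraph \<Rightarrow> 'a set set" where
  "undirected_edges G = {{v, w} | v w. (v, w) \<in> parcs G}"

text \<open>The product over an edge \<open>{v, w}\<close> has exactly two factors because \<open>v \<noteq> w\<close>.\<close>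

definition randic_index :: "'a pair_pre_digraph \<Rightarrow> real" where
  "randic_index G =
     (\<Sum>e\<in>undirected_edges G. 1 / sqrt (\<Prod>v\<in>e. real (vertex_degree G v)))"

text \<open>The list \<open>vs\<close> is the enumeration of the vertices used to index rows and columns.\<close>

definition adjacency_matrix :: "'a list \<Rightarrow> 'a pair_pre_digraph \<Rightarrow> real mat" where
  "adjacency_matrix vs G =
     mat (length vs) (length vs) (\<lambda>(i, j). if (vs ! i, vs ! j) \<in> parcs G then 1 else 0)"

text \<open>
  The multiset \<^term>\<open>proots (char_poly A)\<close> lists the real eigenvalues of \<open>A\<close> with their
  algebraic multiplicities.  Lemma \<open>size_proots_adjacency_matrix\<close> below shows that for an
  adjacency matrix no eigenvalue is lost by working over the reals.
\<close>

definition graph_energy :: "'a list \<Rightarrow> 'a pair_pre_digraph \<Rightarrow> real" where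
  "graph_energy vs G = (\<Sum>x\<in>#proots (char_poly (adjacency_matrix vs G)). \<bar>x\<bar>)"

text \<open>
  The sides of a complete bipartite graph may be empty here: an isolated vertex is the
  component \<open>K\<^bsub>1,0\<^esub>\<close>.
\<close>

definition disjoint_union_of_complete_bipartite :: "'a pair_pre_digraph \<Rightarrow> bool" where
  "disjoint_union_of_complete_bipartite G \<longleftrightarrow>
     (\<exists>C. (\<forall>H\<in>C. \<exists>p q. complete_bipartite_digraph p q (with_proj H)) \<and>
          pairwise (\<lambda>H H'. pverts H \<inter> pverts H' = {}) C \<and>
          pverts G = (\<Union>H\<in>C. pverts H) \<and>
          parcs G = (\<Union>H\<in>C. parcs H))"

lemma symmetric_real_eigenvalue_in_Reals:
  fixes A :: "real mat"
  assumes A: "A \<in> carrier_mat n n"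
    and sym: "\<And>i j. i < n \<Longrightarrow> j < n \<Longrightarrow> A $$ (i, j) = A $$ (j, i)"
    and ev: "eigenvalue (map_mat complex_of_real A) z"
  shows "z \<in> \<real>"
proof -
  let ?A = "map_mat complex_of_real A"
  obtain v where v: "v \<in> carrier_vec n" "v \<noteq> 0\<^sub>v n" "?A *\<^sub>v v = z \<cdot>\<^sub>v v"
    using ev A unfolding eigenvalue_def eigenvector_def by auto
  have row: "(\<Sum>j<n. of_real (A $$ (i, j)) * v $ j) = z * v $ i" if "i < n" for i
  proof -
    have "(?A *\<^sub>v v) $ i = (z \<cdot>\<^sub>v v) $ i" using v by simp
    thus ?thesis using that A v(1)
      by (simp add: scalar_prod_def lessThan_atLeast0)
  qed
  define N where "N = (\<Sum>i<n. v $ i * cnj (v $ i))"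
  define Q where "Q = (\<Sum>i<n. \<Sum>j<n. cnj (v $ i) * of_real (A $$ (i, j)) * v $ j)"
  have N': "N = of_real (\<Sum>i<n. (cmod (v $ i))\<^sup>2)"
    by (simp add: N_def complex_norm_square del: of_real_power)
  obtain k where k: "k < n" "v $ k \<noteq> 0"
    using v(1,2) by (metis carrier_vecD eq_vecI index_zero_vec(1) index_zero_vec(2))
  have "(\<Sum>i<n. (cmod (v $ i))\<^sup>2) > 0"
    by (rule sum_pos2[of _ k]) (use k in auto)
  hence N0: "N \<noteq> 0" unfolding N' by (metis of_real_eq_0_iff less_irrefl)
  have Q: "Q = z * N"
  proof -
    have "Q = (\<Sum>i<n. cnj (v $ i) * (\<Sum>j<n. of_real (A $$ (i, j)) * v $ j))"
      by (simp add: Q_def sum_distrib_left mult.assoc)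
    also have "\<dots> = (\<Sum>i<n. cnj (v $ i) * (z * v $ i))"
      by (rule sum.cong) (use row in auto)
    also have "\<dots> = z * N" by (simp add: N_def sum_distrib_left mult_ac)
    finally show ?thesis .
  qed
  have "cnj Q = (\<Sum>i<n. \<Sum>j<n. v $ i * of_real (A $$ (i, j)) * cnj (v $ j))"
    by (simp add: Q_def)
  also have "\<dots> = (\<Sum>j<n. \<Sum>i<n. v $ i * of_real (A $$ (i, j)) * cnj (v $ j))"
    by (rule sum.swap)
  also have "\<dots> = Q" unfolding Q_def
    by (intro sum.cong refl) (use sym in \<open>auto simp: mult_ac\<close>)
  finally have "cnj z * cnj N = z * N" using Q by simp
  moreover have "cnj N = N" by (simp add: N')
  ultimately have "cnj z = z" using N0 by simp
  thus ?thesis by (simp add: Reals_cnj_iff)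
qed

lemma size_proots_adjacency_matrix:
  assumes "pair_graph G"
  shows "size (proots (char_poly (adjacency_matrix vs G))) = length vs"
proof -
  interpret pair_graph G by fact
  interpret real_poly: map_poly_inj_comm_ring_hom complex_of_real ..
  let ?n = "length vs" and ?A = "adjacency_matrix vs G"
  let ?p = "char_poly (map_mat complex_of_real ?A)"
  have A: "?A \<in> carrier_mat ?n ?n" by (simp add: adjacency_matrix_def)
  have sy: "(x, y) \<in> parcs G \<longleftrightarrow> (y, x) \<in> parcs G" for x y
    using pair_sym_arcs by (auto simp: symmetric_def dest: symD)
  have cA: "map_mat complex_of_real ?A \<in> carrier_mat ?n ?n" using A by simp
  have real: "z \<in> \<real>" if "z \<in># proots ?p" for z
  proof (rule symmetric_real_eigenvalue_in_Reals[OF A])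
    have "?p \<noteq> 0" using degree_monic_char_poly[OF cA] by auto
    thus "eigenvalue (map_mat complex_of_real ?A) z"
      using that eigenvalue_root_char_poly[OF cA] by simp
  qed (auto simp: adjacency_matrix_def sy)
  have "map_poly complex_of_real (char_poly ?A) = ?p"
    using A by (simp add: of_real_hom.char_poly_hom)
  also have "?p = (\<Prod>x\<in>#proots ?p. [:-x, 1:])"
    using complex_poly_decompose_multiset[of ?p] degree_monic_char_poly[OF cA] by simp
  also have "\<dots> = (\<Prod>x\<in>#proots ?p. map_poly complex_of_real [:-Re x, 1:])"
    by (intro arg_cong[where f = prod_mset] image_mset_cong) (use real in auto)
  also have "\<dots> = map_poly complex_of_real (\<Prod>x\<in>#proots ?p. [:-Re x, 1:])"
  proof -
    have "(\<Prod>x\<in>#M. map_poly complex_of_real [:-Re x, 1:]) =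
        map_poly complex_of_real (\<Prod>x\<in>#M. [:-Re x, 1:])" for M
      by (induction M) (simp_all add: real_poly.hom_mult del: mult_pCons_left)
    thus ?thesis .
  qed
  finally have "char_poly ?A = (\<Prod>x\<in>#proots ?p. [:-Re x, 1:])"
    unfolding real_poly.eq_iff .
  also have "proots \<dots> = image_mset Re (proots ?p)"
  proof -
    have "proots (\<Prod>x\<in>#M. [:-Re x, 1:]) = image_mset Re M" for M
    proof (induction M)
      case (add x M)
      have "(\<Prod>x\<in>#M. [:-Re x, 1:]) \<noteq> 0" by auto
      moreover have "proots [:-Re x, 1:] = {#Re x#}"
        by simp
      ultimately show ?case using add by (simp add: proots_mult del: mult_pCons_left)
    qed simp
    thus ?thesis .
  qed
  finally have "size (proots (char_poly ?A)) = size (proots ?p)" by simp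
  thus ?thesis using degree_monic_char_poly[OF cA] size_proots_complex[of ?p] by simp
qed

end

theory Submission
  imports Defs "Jordan_Normal_Form.Spectral_Radius"
begin

text \<open>
  Both implications come from one exact formula for \<open>\<E>(G) - 2 R(G)\<close>.  Let \<open>u\<^sub>k\<close> be an orthonormal
  eigenbasis of the adjacency matrix \<open>A\<close> with eigenvalues \<open>\<lambda>\<^sub>k\<close>, and write \<open>d\<close> for the degree.
  Twice the Randic index is the sum over all arcs \<open>(v, w)\<close> of
  \<open>A\<^sub>v\<^sub>w / sqrt (d v d w)\<close>; inserting \<open>A\<^sub>v\<^sub>w = \<Sum>k. \<lambda>\<^sub>k u\<^sub>k(v) u\<^sub>k(w)\<close> expresses it through the quadratic
  form of the normalized adjacency matrix at the vectors \<open>u\<^sub>k\<close>.  That form is at most \<open>1\<close> in absolute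
  value on unit vectors, and for vectors that vanish at the isolated vertices the defect is half a sum
  of squares over the arcs, namely the Dirichlet form of the normalized Laplacian or of its signless
  version, depending on the sign.  Hence
  (lemma \<open>energy_minus_twice_randic_index\<close>)

  \<open>\<E>(G) - 2 R(G) = \<Sum>k. \<bar>\<lambda>\<^sub>k\<bar> / 2 * (\<Sum>(v, w). (u\<^sub>k(v) / sqrt (d v) - sgn \<lambda>\<^sub>k * u\<^sub>k(w) / sqrt (d w))\<^sup>2).\<close>

  So equality holds exactly when every eigenvector with a nonzero eigenvalue is balanced: along each
  edge \<open>u\<^sub>k / sqrt d\<close> is preserved up to the sign of \<open>\<lambda>\<^sub>k\<close>.

  If all these eigenvectors are balanced, then \<open>u\<^sub>k / sqrt d\<close> agrees at any two vertices \<open>v\<close>, \<open>x\<close> with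
  a common neighbour.  By the spectral decomposition the rows \<open>v\<close> and \<open>x\<close> of \<open>A\<close> are then proportional,
  so \<open>v\<close> and \<open>x\<close> have the same neighbours.  In other words, the two ends of every walk of
  length three are adjacent, and this says that every component is complete bipartite
  (lemma \<open>complete_bipartite_union_iff_walks_close\<close>).  Conversely, in such a graph an eigenvector for
  \<open>\<lambda> \<noteq> 0\<close> is constant on each side of a component, which forces \<open>\<lambda>\<^sup>2 = d v d w\<close> along every edge
  on which it does not vanish, and balance follows (lemma \<open>eigenvector_balanced_if_walks_close\<close>).
\<close>

section \<open>Orthogonal diagonalization of real symmetric matrices\<close>

text \<open>
  The complexified matrix has an eigenvalue because its characteristic polynomial has a complex root.
  By symmetry this root is real, so it is a root of the real characteristic polynomial as well.
\<close>

lemma symmetric_real_matrix_has_unit_eigenvector: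
  fixes A :: "real mat"
  assumes A: "A \<in> carrier_mat n n" and sym: "transpose_mat A = A" and n: "n > 0"
  obtains v r where "v \<in> carrier_vec n" "v \<bullet> v = 1" "A *\<^sub>v v = r \<cdot>\<^sub>v v"
proof -
  let ?A = "map_mat complex_of_real A"
  have cA: "?A \<in> carrier_mat n n" using A by simp
  have sym': "A $$ (i, j) = A $$ (j, i)" if "i < n" "j < n" for i j
    using that A index_transpose_mat(1)[of i A j] sym by simp
  obtain z where z: "eigenvalue ?A z"
    using spectrum_non_empty[OF cA n] by (auto simp: spectrum_def)
  then obtain r where r: "z = of_real r"
    using symmetric_real_eigenvalue_in_Reals[OF A sym'] by (auto elim: Reals_cases)
  have "poly (map_poly complex_of_real (char_poly A)) (of_real r) = 0"
    using z eigenvalue_root_char_poly[OF cA] A by (simp add: r of_real_hom.char_poly_hom)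
  hence "eigenvalue A r"
    using eigenvalue_root_char_poly[OF A] by simp
  then obtain w where w: "w \<in> carrier_vec n" "w \<noteq> 0\<^sub>v n" "A *\<^sub>v w = r \<cdot>\<^sub>v w"
    using A by (auto simp: eigenvalue_def eigenvector_def)
  define c where "c = 1 / sqrt (w \<bullet> w)"
  have pos: "w \<bullet> w > 0"
  proof -
    have "conjugate w = w" by (rule eq_vecI) auto
    thus ?thesis using conjugate_square_greater_0_vec[OF w(1)] w(2) by simp
  qed
  have "(c \<cdot>\<^sub>v w) \<bullet> (c \<cdot>\<^sub>v w) = c * c * (w \<bullet> w)"
    using w(1) by simp
  also have "\<dots> = 1" using pos by (simp add: c_def)
  finally have "(c \<cdot>\<^sub>v w) \<bullet> (c \<cdot>\<^sub>v w) = 1" .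
  moreover have "A *\<^sub>v (c \<cdot>\<^sub>v w) = r \<cdot>\<^sub>v (c \<cdot>\<^sub>v w)"
    using w A by (simp add: mult_mat_vec[OF A] smult_smult_assoc mult.commute)
  ultimately show ?thesis using w(1) that[of "c \<cdot>\<^sub>v w" r] by simp
qed

text \<open>
  The reflection in the hyperplane orthogonal to \<open>v - e\<^sub>0\<close> swaps \<open>e\<^sub>0\<close> and \<open>v\<close>.  It extends \<open>v\<close> to an
  orthonormal basis explicitly, without an orthogonalization procedure.
\<close>

lemma householder_reflection:
  fixes v :: "real vec"
  assumes v: "v \<in> carrier_vec n" and unit: "v \<bullet> v = 1" and n: "n > 0"
  obtains H where "H \<in> carrier_mat n n" "transpose_mat H = H" "H * H = 1\<^sub>m n" "col H 0 = v"
proof -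
  define e where "e i = (if i = 0 then 1 else 0 :: real)" for i :: nat
  define w where "w i = v $ i - e i" for i
  define c where "c = 2 / (\<Sum>i<n. w i * w i)"
  \<comment> \<open>If \<open>v = e\<^sub>0\<close>, then \<open>c = 2 / 0 = 0\<close> and \<open>H\<close> is the identity, as required.\<close>
  define H where "H = mat n n (\<lambda>(i, j). (if i = j then 1 else 0) - c * w i * w j)"
  have Hc: "H \<in> carrier_mat n n" by (simp add: H_def)
  have vv: "(\<Sum>i<n. v $ i * v $ i) = 1"
    using unit v by (simp add: scalar_prod_def lessThan_atLeast0)
  have "(\<Sum>i<n. w i * w i) = (\<Sum>i<n. v $ i * v $ i + (if i = 0 then 1 - 2 * v $ 0 else 0))"
    by (intro sum.cong) (auto simp: w_def e_def algebra_simps)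
  also have "\<dots> = 2 - 2 * v $ 0"
    using n by (simp add: sum.distrib vv)
  finally have ww: "(\<Sum>i<n. w i * w i) = 2 - 2 * v $ 0" .
  have cc: "c * c * (\<Sum>i<n. w i * w i) = 2 * c"
    by (simp add: c_def)
  have "transpose_mat H = H"
    by (rule eq_matI) (auto simp: H_def)
  moreover have "H * H = 1\<^sub>m n"
  proof (rule eq_matI)
    fix i j assume ij: "i < dim_row (1\<^sub>m n :: real mat)" "j < dim_col (1\<^sub>m n :: real mat)"
    have "(H * H) $$ (i, j) =
        (\<Sum>k<n. ((if i = k then 1 else 0) - c * w i * w k) * ((if k = j then 1 else 0) - c * w k * w j))"
      using ij by (simp add: H_def scalar_prod_def lessThan_atLeast0)
    also have "\<dots> = (\<Sum>k<n. (if k = i then (if i = j then 1 else 0) else 0)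
        - (if k = i then c * w i * w j else 0) - (if k = j then c * w i * w j else 0)
        + w i * w j * (c * c * (w k * w k)))"
      by (intro sum.cong refl) (auto simp: algebra_simps)
    also have "\<dots> = (if i = j then 1 else 0) - 2 * (c * w i * w j)
        + w i * w j * (c * c * (\<Sum>k<n. w k * w k))"
      using ij by (simp add: sum.distrib sum_subtractf flip: sum_distrib_left)
    also have "\<dots> = 1\<^sub>m n $$ (i, j)" unfolding cc using ij by simp
    finally show "(H * H) $$ (i, j) = 1\<^sub>m n $$ (i, j)" .
  qed (simp_all add: H_def)
  moreover have "col H 0 = v"
  proof (rule eq_vecI)
    fix i assume "i < dim_vec v"
    hence i: "i < n" using v by simp
    have "e i - c * w i * w 0 = v $ i"
    proof (cases "v $ 0 = 1")
      case True
      hence "(\<Sum>i<n. w i * w i) = 0" using ww by simp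
      hence "\<forall>i\<in>{..<n}. w i * w i = 0"
        by (subst (asm) sum_nonneg_eq_0_iff) auto
      hence "w i = 0" using i by auto
      thus ?thesis by (simp add: w_def)
    next
      case False
      hence "c * w 0 = -1" 
        unfolding c_def ww by (simp add: w_def e_def divide_simps)
      hence "c * w i * w 0 = - w i" by (metis mult.commute mult.left_commute mult_minus1)
      thus ?thesis by (simp add: w_def)
    qed
    thus "col H 0 $ i = v $ i" using i n by (simp add: H_def e_def)
  qed (use v in \<open>simp add: H_def\<close>)
  ultimately show ?thesis using Hc that by blast
qed

text \<open>
  Induction on the dimension by deflation.  Conjugating with a reflection \<open>H\<close> that takes \<open>e\<^sub>0\<close> to a
  unit eigenvector makes the first column of the matrix a multiple of \<open>e\<^sub>0\<close>; by symmetry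
  the first row is one too, and the remaining block is symmetric of smaller size.
\<close>

lemma symmetric_real_matrix_diagonalization:
  fixes A :: "real mat"
  assumes "A \<in> carrier_mat n n" and "transpose_mat A = A"
  shows "\<exists>U d. U \<in> carrier_mat n n \<and> transpose_mat U * U = 1\<^sub>m n \<and>
    A = U * mat_diag n d * transpose_mat U"
  using assms
proof (induction n arbitrary: A)
  case 0
  show ?case
    by (rule exI[of _ "1\<^sub>m 0"], rule exI[of _ "\<lambda>_. 0"]) (use 0 in auto)
next
  case (Suc m)
  let ?n = "Suc m"
  obtain v r where v: "v \<in> carrier_vec ?n" "v \<bullet> v = 1" "A *\<^sub>v v = r \<cdot>\<^sub>v v"
    using symmetric_real_matrix_has_unit_eigenvector[OF Suc.prems] by blast
  obtain H where H: "H \<in> carrier_mat ?n ?n" "transpose_mat H = H" "H * H = 1\<^sub>m ?n" "col H 0 = v"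
    using householder_reflection[OF v(1,2)] by blast
  note carrier = Suc.prems(1) H(1)
  define M where "M = H * A * H"
  have M: "M \<in> carrier_mat ?n ?n" using carrier by (simp add: M_def)
  have Msym: "transpose_mat M = M"
    using carrier Suc.prems(2) H(2)
    by (simp add: M_def transpose_mult[of _ ?n ?n _ ?n] assoc_mult_mat[of _ ?n ?n _ ?n _ ?n])
  have "col M 0 = H *\<^sub>v (A *\<^sub>v col H 0)"
    using carrier col_mult2[of H ?n ?n "A * H" ?n 0] col_mult2[of A ?n ?n H ?n 0]
    by (simp add: M_def assoc_mult_mat[of _ ?n ?n _ ?n _ ?n] del: col_mult2)
  also have "\<dots> = r \<cdot>\<^sub>v (H *\<^sub>v col H 0)"
    using v H by (simp add: mult_mat_vec[of _ ?n ?n])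
  also have "H *\<^sub>v col H 0 = col (H * H) 0"
    by (rule col_mult2[OF H(1) H(1), symmetric]) simp
  also have "r \<cdot>\<^sub>v \<dots> = r \<cdot>\<^sub>v unit_vec ?n 0" using H(3) by simp
  finally have col0: "M $$ (i, 0) = (if i = 0 then r else 0)" if "i < ?n" for i
    using that M by (auto simp: vec_eq_iff)
  have row0: "M $$ (0, i) = (if i = 0 then r else 0)" if "i < ?n" for i
    using col0[OF that] index_transpose_mat(1)[of 0 M i] that M Msym by simp
  define B where "B = mat m m (\<lambda>(i, j). M $$ (Suc i, Suc j))"
  have B: "B \<in> carrier_mat m m" by (simp add: B_def)
  have Bsym: "transpose_mat B = B"
  proof (rule eq_matI)
    fix i j assume "i < dim_row B" "j < dim_col B"
    thus "transpose_mat B $$ (i, j) = B $$ (i, j)"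
      using index_transpose_mat(1)[of "Suc i" M "Suc j"] M Msym by (simp add: B_def)
  qed (simp_all add: B_def)
  let ?r = "mat 1 1 (\<lambda>_. r)"
  have MB: "M = four_block_mat ?r (0\<^sub>m 1 m) (0\<^sub>m m 1) B"
    by (rule eq_matI) (use M col0 row0 in \<open>auto simp: B_def\<close>)
  obtain W d where W: "W \<in> carrier_mat m m" "transpose_mat W * W = 1\<^sub>m m"
    and BW: "B = W * mat_diag m d * transpose_mat W"
    using Suc.IH[OF B Bsym] by blast
  define V where "V = four_block_mat (1\<^sub>m 1) (0\<^sub>m 1 m) (0\<^sub>m m 1) W"
  define d' where "d' = (\<lambda>i. case i of 0 \<Rightarrow> r | Suc j \<Rightarrow> d j)"
  have V: "V \<in> carrier_mat ?n ?n"
    using four_block_carrier_mat[of "1\<^sub>m 1" 1 1 W m m] W(1) by (simp add: V_def)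
  have VT: "transpose_mat V = four_block_mat (1\<^sub>m 1) (0\<^sub>m 1 m) (0\<^sub>m m 1) (transpose_mat W)"
    unfolding V_def by (subst transpose_four_block_mat) (use W in auto)
  have D: "mat_diag ?n d' = four_block_mat ?r (0\<^sub>m 1 m) (0\<^sub>m m 1) (mat_diag m d)"
    by (rule eq_matI) (auto simp: mat_diag_def d'_def split: nat.split)
  have VV: "transpose_mat V * V = 1\<^sub>m ?n"
    unfolding VT unfolding V_def
    by (subst mult_four_block_mat) (use W four_block_one_mat[of 1 m] in auto)
  have MV: "M = V * mat_diag ?n d' * transpose_mat V"
  proof -
    have "V * mat_diag ?n d' = four_block_mat ?r (0\<^sub>m 1 m) (0\<^sub>m m 1) (W * mat_diag m d)"
      unfolding V_def D by (subst mult_four_block_mat)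
        (use W in \<open>auto simp: left_mult_zero_mat[of _ m m] right_mult_zero_mat[of _ m m]\<close>)
    thus ?thesis
      unfolding VT MB BW by (simp, subst mult_four_block_mat)
        (use W in \<open>auto simp: left_mult_zero_mat[of _ m m] right_mult_zero_mat[of _ m m]\<close>)
  qed
  have HH: "H * (H * X) = X" if "X \<in> carrier_mat ?n ?n" for X
    using that H by (simp flip: assoc_mult_mat[of _ ?n ?n _ ?n _ ?n])
  note carrier = carrier V mat_diag_dim[of ?n d']
  have "A = H * M * H"
    using carrier H(3) by (simp add: M_def HH assoc_mult_mat[of _ ?n ?n _ ?n _ ?n])
  also have "\<dots> = (H * V) * mat_diag ?n d' * transpose_mat (H * V)"
    using carrier H(2) by (simp add: MV mult_carrier_mat[of _ ?n ?n _ ?n] transpose_mult[of _ ?n ?n _ ?n] assoc_mult_mat[of _ ?n ?n _ ?n _ ?n])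
  finally have "A = (H * V) * mat_diag ?n d' * transpose_mat (H * V)" .
  moreover have "transpose_mat (H * V) * (H * V) = 1\<^sub>m ?n"
    using carrier H(2) VV by (simp add: HH mult_carrier_mat[of _ ?n ?n _ ?n] transpose_mult[of _ ?n ?n _ ?n] assoc_mult_mat[of _ ?n ?n _ ?n _ ?n])
  moreover have "H * V \<in> carrier_mat ?n ?n" using carrier by simp
  ultimately show ?case by blast
qed

section \<open>Sums over the arcs of a graph\<close>

lemma pair_graph_arcs_sym:
  assumes "pair_graph G"
  shows "(v, w) \<in> parcs G \<longleftrightarrow> (w, v) \<in> parcs G"
proof -
  interpret pair_graph G by fact
  show ?thesis using pair_sym_arcs by (auto simp: symmetric_def dest: symD)
qed

lemma pair_graph_arcs_Sigma:
  assumes "pair_graph G"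
  shows "parcs G = Sigma (pverts G) (\<lambda>v. parcs G `` {v})"
    and "v \<in> pverts G \<Longrightarrow> finite (parcs G `` {v})"
    and "finite (pverts G)" and "finite (parcs G)" and "parcs G `` {v} \<subseteq> pverts G"
proof -
  interpret pair_graph G by fact
  show "parcs G = Sigma (pverts G) (\<lambda>v. parcs G `` {v})" by (auto dest: wellformed')
  show sub: "parcs G `` {v} \<subseteq> pverts G" by (auto dest: wellformed')
  show "finite (pverts G)" by (rule pair_finite_verts)
  thus "v \<in> pverts G \<Longrightarrow> finite (parcs G `` {v})" using sub finite_subset by blast
  show "finite (parcs G)" by (rule pair_finite_arcs)
qed

lemma vertex_degree_eq_card_Image:
  assumes "pair_graph G"
  shows "vertex_degree G v = card (parcs G `` {v})"
proof -
  have "{w \<in> pverts G. (v, w) \<in> parcs G} = parcs G `` {v}"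
    using pair_graph_arcs_Sigma(5)[OF assms] by auto
  thus ?thesis by (simp add: vertex_degree_def)
qed

lemma vertex_degree_pos:
  assumes "pair_graph G" "(v, w) \<in> parcs G"
  shows "vertex_degree G v > 0"
  using assms pair_graph_arcs_Sigma(1,2)[OF assms(1)]
  unfolding vertex_degree_eq_card_Image[OF assms(1)] card_gt_0_iff by blast

lemma sum_arcs_by_tail:
  fixes g :: "'a \<Rightarrow> 'a \<Rightarrow> real"
  assumes "pair_graph G"
  shows "(\<Sum>(v, w)\<in>parcs G. g v w) = (\<Sum>v\<in>pverts G. \<Sum>w\<in>parcs G `` {v}. g v w)"
  using pair_graph_arcs_Sigma[OF assms]
  by (subst sum.Sigma) auto

lemma sum_arcs_swap:
  fixes g :: "'a \<Rightarrow> 'a \<Rightarrow> real"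
  assumes "pair_graph G"
  shows "(\<Sum>(v, w)\<in>parcs G. g w v) = (\<Sum>(v, w)\<in>parcs G. g v w)"
  by (rule sum.reindex_bij_witness[of _ prod.swap prod.swap])
    (use pair_graph_arcs_sym[OF assms] in auto)

text \<open>
  Each edge \<open>{v, w}\<close> is the image of exactly two arcs, \<open>(v, w)\<close> and \<open>(w, v)\<close>, and both contribute the
  same amount.
\<close>

lemma twice_randic_index:
  assumes G: "pair_graph G"
  shows "2 * randic_index G =
    (\<Sum>(v, w)\<in>parcs G. 1 / sqrt (vertex_degree G v * vertex_degree G w))"
proof -
  interpret pair_graph G by fact
  let ?f = "\<lambda>(v, w). 1 / sqrt (vertex_degree G v * vertex_degree G w)"
  let ?e = "\<lambda>(v, w). {v, w}"
  have edges: "undirected_edges G = ?e ` parcs G" by (auto simp: undirected_edges_def)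
  have "(\<Sum>a\<in>parcs G. ?f a) = (\<Sum>e\<in>undirected_edges G. \<Sum>a\<in>{a\<in>parcs G. ?e a = e}. ?f a)"
    unfolding edges by (rule sum.image_gen) (rule pair_finite_arcs)
  also have "\<dots> = (\<Sum>e\<in>undirected_edges G. 2 * (1 / sqrt (\<Prod>v\<in>e. real (vertex_degree G v))))"
  proof (rule sum.cong)
    fix e assume "e \<in> undirected_edges G"
    then obtain v w where e: "e = {v, w}" "(v, w) \<in> parcs G"
      by (auto simp: undirected_edges_def)
    have neq: "v \<noteq> w" using pair_no_loops[OF e(2)] by simp
    have "{a \<in> parcs G. ?e a = e} = {(v, w), (w, v)}"
      using e pair_graph_arcs_sym[OF G] by (auto simp: doubleton_eq_iff)
    thus "(\<Sum>a\<in>{a\<in>parcs G. ?e a = e}. ?f a) = 2 * (1 / sqrt (\<Prod>v\<in>e. real (vertex_degree G v)))"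
      using neq by (simp add: e mult.commute)
  qed simp
  finally show ?thesis by (simp add: randic_index_def sum_distrib_left)
qed

text \<open>
  The squares expand into terms \<open>f\<^sup>2 / deg\<close>, one for each arc at a vertex and thus \<open>f\<^sup>2\<close> in total, and
  the cross terms.  At an isolated vertex there is no arc that could produce \<open>f\<^sup>2\<close>, so \<open>f\<close> must vanish
  there.  For \<open>s = 1\<close> and \<open>s = -1\<close> this bounds the quadratic form of the normalized adjacency matrix
  from above and below.
\<close>

lemma normalized_dirichlet_form:
  fixes f :: "'a \<Rightarrow> real"
  assumes G: "pair_graph G"
    and isolated: "\<And>v. v \<in> pverts G \<Longrightarrow> vertex_degree G v = 0 \<Longrightarrow> f v = 0"
    and s: "s\<^sup>2 = 1"
  defines "d \<equiv> \<lambda>v. sqrt (vertex_degree G v)"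
  shows "(\<Sum>(v, w)\<in>parcs G. (f v / d v - s * (f w / d w))\<^sup>2) =
    2 * (\<Sum>v\<in>pverts G. (f v)\<^sup>2) - 2 * s * (\<Sum>(v, w)\<in>parcs G. f v * f w / (d v * d w))"
proof -
  let ?S = "\<Sum>(v, w)\<in>parcs G. (f v / d v)\<^sup>2"
  have "(\<Sum>(v, w)\<in>parcs G. (f v / d v - s * (f w / d w))\<^sup>2) =
      (\<Sum>(v, w)\<in>parcs G. (f v / d v)\<^sup>2 + (f w / d w)\<^sup>2 - 2 * s * (f v * f w / (d v * d w)))"
  proof (rule sum.cong, rule refl, clarify)
    fix v w
    have "(x - s * y)\<^sup>2 = x\<^sup>2 + y\<^sup>2 - 2 * s * (x * y)" for x y
      using s by (simp add: power2_diff power_mult_distrib)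
    from this[of "f v / d v" "f w / d w"]
    show "(f v / d v - s * (f w / d w))\<^sup>2 =
        (f v / d v)\<^sup>2 + (f w / d w)\<^sup>2 - 2 * s * (f v * f w / (d v * d w))"
      by simp
  qed
  also have "\<dots> = ?S + (\<Sum>(v, w)\<in>parcs G. (f w / d w)\<^sup>2)
      - 2 * s * (\<Sum>(v, w)\<in>parcs G. f v * f w / (d v * d w))"
    by (simp add: sum.distrib sum_subtractf sum_distrib_left case_prod_beta)
  also have "(\<Sum>(v, w)\<in>parcs G. (f w / d w)\<^sup>2) = ?S"
    by (rule sum_arcs_swap[OF G])
  also have "?S = (\<Sum>v\<in>pverts G. vertex_degree G v * (f v / d v)\<^sup>2)"
    by (simp add: sum_arcs_by_tail[OF G] vertex_degree_eq_card_Image[OF G])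
  also have "\<dots> = (\<Sum>v\<in>pverts G. (f v)\<^sup>2)"
    using isolated by (intro sum.cong refl) (auto simp: d_def power_divide)
  finally show ?thesis by simp
qed

section \<open>The gap between energy and twice the Randic index\<close>

text \<open>
  The diagonalization of the adjacency matrix, with rows and columns relabelled by vertices.  The
  last identity holds because similar matrices have the same characteristic polynomial, so the
  diagonal entries are the roots with their multiplicities.
\<close>

lemma adjacency_matrix_eigenbasis:
  fixes G :: "'a pair_pre_digraph"
  assumes G: "pair_graph G" and vs: "distinct vs" "set vs = pverts G"
  obtains u :: "nat \<Rightarrow> 'a \<Rightarrow> real" and l :: "nat \<Rightarrow> real" where
    "\<And>k. k < length vs \<Longrightarrow> (\<Sum>v\<in>pverts G. (u k v)\<^sup>2) = 1"
    "\<And>k v. k < length vs \<Longrightarrow> v \<in> pverts G \<Longrightarrow> l k * u k v = (\<Sum>w\<in>parcs G `` {v}. u k w)"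
    "\<And>v w. v \<in> pverts G \<Longrightarrow> w \<in> pverts G \<Longrightarrow>
      (\<Sum>k<length vs. l k * (u k v * u k w)) = (if (v, w) \<in> parcs G then 1 else 0)"
    "graph_energy vs G = (\<Sum>k<length vs. \<bar>l k\<bar>)"
proof -
  let ?n = "length vs" and ?A = "adjacency_matrix vs G"
  have A: "?A \<in> carrier_mat ?n ?n" by (simp add: adjacency_matrix_def)
  have "transpose_mat ?A = ?A"
    by (rule eq_matI) (auto simp: adjacency_matrix_def pair_graph_arcs_sym[OF G])
  then obtain U l where U: "U \<in> carrier_mat ?n ?n" "transpose_mat U * U = 1\<^sub>m ?n"
    and AU: "?A = U * mat_diag ?n l * transpose_mat U"
    using symmetric_real_matrix_diagonalization[OF A] by blast
  define ix where "ix = the_inv_into {..<?n} (nth vs)"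
  define u where "u k v = U $$ (ix v, k)" for k v
  have bij: "bij_betw (nth vs) {..<?n} (pverts G)"
    using bij_betw_nth[OF vs(1) refl refl] vs(2) by simp
  have u: "u k (vs ! i) = U $$ (i, k)" if "i < ?n" for i k
    using that the_inv_into_f_f[OF bij_betw_imp_inj_on[OF bij], of i] by (simp add: u_def ix_def)
  have vertex: "\<exists>i<?n. v = vs ! i" if "v \<in> pverts G" for v
    using that vs by (metis in_set_conv_nth)
  have sum_vertices: "(\<Sum>v\<in>pverts G. g v) = (\<Sum>i<?n. g (vs ! i))" for g :: "'a \<Rightarrow> real"
    by (rule sum.reindex_bij_betw[OF bij, symmetric])
  have a: "?A $$ (i, j) = (if (vs ! i, vs ! j) \<in> parcs G then 1 else 0)" if "i < ?n" "j < ?n" for i j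
    using that by (simp add: adjacency_matrix_def)
  note D = mat_diag_dim[of ?n l]
  show thesis
  proof (rule that[of u l])
    fix k assume k: "k < ?n"
    have "(transpose_mat U * U) $$ (k, k) = 1" using U k by simp
    thus "(\<Sum>v\<in>pverts G. (u k v)\<^sup>2) = 1"
      using U(1) k by (simp add: sum_vertices u scalar_prod_def lessThan_atLeast0 power2_eq_square)
    fix v assume "v \<in> pverts G"
    then obtain i where i: "i < ?n" "v = vs ! i" using vertex by blast
    have "?A * U = U * mat_diag ?n l * (transpose_mat U * U)"
      unfolding AU by (rule assoc_mult_mat[of _ ?n ?n _ ?n _ ?n]) (use U(1) D in auto)
    hence "?A * U = U * mat_diag ?n l" using U D by simp
    hence "(?A * U) $$ (i, k) = (U * mat_diag ?n l) $$ (i, k)" by simp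
    hence "(\<Sum>j<?n. ?A $$ (i, j) * U $$ (j, k)) = U $$ (i, k) * l k"
      using U(1) A i k by (simp add: mat_diag_mult_right[OF U(1)] scalar_prod_def lessThan_atLeast0)
    hence "l k * u k v = (\<Sum>j<?n. ?A $$ (i, j) * U $$ (j, k))" using i by (simp add: u)
    also have "\<dots> = (\<Sum>w\<in>pverts G. if (v, w) \<in> parcs G then u k w else 0)"
      unfolding sum_vertices by (intro sum.cong) (auto simp: a u i)
    also have "\<dots> = (\<Sum>w\<in>parcs G `` {v}. u k w)"
      using pair_graph_arcs_Sigma(3,5)[OF G]
      by (intro sum.mono_neutral_cong_right) auto
    finally show "l k * u k v = (\<Sum>w\<in>parcs G `` {v}. u k w)" .
  next
    fix v w assume "v \<in> pverts G" "w \<in> pverts G"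
    then obtain i j where ij: "i < ?n" "v = vs ! i" "j < ?n" "w = vs ! j" using vertex by metis
    have "?A $$ (i, j) = (\<Sum>k<?n. U $$ (i, k) * l k * U $$ (j, k))"
      unfolding AU mat_diag_mult_right[OF U(1)]
      using ij U(1) by (simp add: scalar_prod_def lessThan_atLeast0)
    thus "(\<Sum>k<?n. l k * (u k v * u k w)) = (if (v, w) \<in> parcs G then 1 else 0)"
      using ij by (simp add: a u mult_ac)
  next
    have UT: "U * transpose_mat U = 1\<^sub>m ?n"
      by (rule mat_mult_left_right_inverse[OF _ U(1) U(2)]) (use U(1) in simp)
    have "similar_mat ?A (mat_diag ?n l)"
      by (rule similar_matI[OF _ UT U(2) AU]) (use A U(1) in simp)
    hence "char_poly ?A = char_poly (mat_diag ?n l)" by (rule char_poly_similar)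
    also have "\<dots> = (\<Prod>a\<leftarrow>map l [0..<?n]. [:-a, 1:])"
      by (subst char_poly_upper_triangular[OF D])
        (auto simp: mat_diag_def diag_mat_def upper_triangular_def intro!: arg_cong[where f = prod_list])
    also have "proots \<dots> = mset (map l [0..<?n])"
    proof -
      have "proots (\<Prod>a\<leftarrow>xs. [:-a, 1:]) = mset xs" for xs :: "real list"
      proof (induction xs)
        case (Cons x xs)
        have "(\<Prod>a\<leftarrow>xs. [:-a, 1:]) \<noteq> 0" by (auto simp: prod_list_zero_iff)
        thus ?case using Cons by (simp add: proots_mult del: mult_pCons_left)
      qed simp
      thus ?thesis .
    qed
    finally show "graph_energy vs G = (\<Sum>k<?n. \<bar>l k\<bar>)"
      by (simp add: graph_energy_def sum_mset_sum_list interv_sum_list_conv_sum_set_nat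
          lessThan_atLeast0 flip: mset_map)
  qed
qed

text \<open>
  Replacing each numerator \<open>1 = A\<^sub>v\<^sub>w\<close> of the Randic sum by its spectral expansion splits \<open>2 R(G)\<close> into
  one quadratic form per eigenvector.  For \<open>l k \<noteq> 0\<close> the eigenvector equation makes \<open>u k\<close> vanish at
  isolated vertices, so the Dirichlet identity applies with \<open>s = sgn (l k)\<close>.
\<close>

lemma energy_minus_twice_randic_index:
  fixes G :: "'a pair_pre_digraph"
  assumes G: "pair_graph G"
    and energy: "graph_energy vs G = (\<Sum>k<n. \<bar>l k\<bar>)"
    and unit: "\<And>k. k < n \<Longrightarrow> (\<Sum>v\<in>pverts G. (u k v)\<^sup>2) = 1"
    and eigen: "\<And>k v. k < n \<Longrightarrow> v \<in> pverts G \<Longrightarrow> l k * u k v = (\<Sum>w\<in>parcs G `` {v}. u k w)"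
    and spectral: "\<And>v w. (v, w) \<in> parcs G \<Longrightarrow> (\<Sum>k<n. l k * (u k v * u k w)) = 1"
  defines "d \<equiv> \<lambda>v. sqrt (vertex_degree G v)"
  shows "graph_energy vs G - 2 * randic_index G =
    (\<Sum>k<n. \<bar>l k\<bar> / 2 * (\<Sum>(v, w)\<in>parcs G. (u k v / d v - sgn (l k) * (u k w / d w))\<^sup>2))"
proof -
  have "2 * randic_index G = (\<Sum>(v, w)\<in>parcs G. (\<Sum>k<n. l k * (u k v * u k w)) / (d v * d w))"
    unfolding twice_randic_index[OF G]
    by (rule sum.cong) (auto simp: d_def spectral real_sqrt_mult)
  also have "\<dots> = (\<Sum>a\<in>parcs G. \<Sum>k<n. l k * (u k (fst a) * u k (snd a) / (d (fst a) * d (snd a))))"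
    by (simp add: case_prod_beta sum_divide_distrib)
  also have "\<dots> = (\<Sum>k<n. l k * (\<Sum>(v, w)\<in>parcs G. u k v * u k w / (d v * d w)))"
    by (subst sum.swap) (simp add: sum_distrib_left case_prod_beta)
  finally have R: "2 * randic_index G = \<dots>" .
  have each: "\<bar>l k\<bar> - l k * (\<Sum>(v, w)\<in>parcs G. u k v * u k w / (d v * d w)) =
      \<bar>l k\<bar> / 2 * (\<Sum>(v, w)\<in>parcs G. (u k v / d v - sgn (l k) * (u k w / d w))\<^sup>2)"
    if k: "k < n" for k
  proof (cases "l k = 0")
    case False
    let ?B = "\<Sum>(v, w)\<in>parcs G. u k v * u k w / (d v * d w)"
    have "(\<Sum>(v, w)\<in>parcs G. (u k v / d v - sgn (l k) * (u k w / d w))\<^sup>2) =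
        2 * (\<Sum>v\<in>pverts G. (u k v)\<^sup>2) - 2 * sgn (l k) * ?B"
      unfolding d_def
    proof (rule normalized_dirichlet_form[OF G])
      fix v assume v: "v \<in> pverts G" "vertex_degree G v = 0"
      hence "parcs G `` {v} = {}"
        using pair_graph_arcs_Sigma(2)[OF G v(1)] by (simp add: vertex_degree_eq_card_Image[OF G])
      thus "u k v = 0" using eigen[OF k v(1)] False by simp
    next
      show "(sgn (l k))\<^sup>2 = 1" using False by (simp add: sgn_real_def)
    qed
    hence "\<bar>l k\<bar> / 2 * (\<Sum>(v, w)\<in>parcs G. (u k v / d v - sgn (l k) * (u k w / d w))\<^sup>2) =
        \<bar>l k\<bar> - \<bar>l k\<bar> * sgn (l k) * ?B"
      using unit[OF k] by (simp add: right_diff_distrib)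
    thus ?thesis by (simp add: abs_mult_sgn)
  qed simp
  show ?thesis
    unfolding energy R sum_subtractf[symmetric] by (rule sum.cong[OF refl], rule each) simp
qed

section \<open>Walks of length three in unions of complete bipartite graphs\<close>

text \<open>
  If the ends of every walk of length three are adjacent, then vertices with a common neighbour have
  equal neighbourhoods, and the component of \<open>v\<close> has the sides \<open>V v\<close>, the neighbours of \<open>v\<close>, and \<open>U v\<close>,
  the vertices having a neighbour in common with \<open>v\<close>.  A vertex common to both sides would be its
  own neighbour.
\<close>

lemma complete_bipartite_union_iff_walks_close:
  assumes G: "pair_graph G"
  shows "disjoint_union_of_complete_bipartite G \<longleftrightarrow>
    (\<forall>v w x y. (v, w) \<in> parcs G \<longrightarrow> (w, x) \<in> parcs G \<longrightarrow> (x, y) \<in> parcs G \<longrightarrow> (v, y) \<in> parcs G)"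
    (is "_ \<longleftrightarrow> ?closed")
proof
  assume "disjoint_union_of_complete_bipartite G"
  then obtain C where
    K: "\<forall>H\<in>C. \<exists>p q. complete_bipartite_digraph p q (with_proj H)" and
    disj: "pairwise (\<lambda>H H'. pverts H \<inter> pverts H' = {}) C" and
    arcs: "parcs G = (\<Union>H\<in>C. parcs H)"
    unfolding disjoint_union_of_complete_bipartite_def by (elim exE conjE) rule
  have bip: "\<exists>U V. pverts H = U \<union> V \<and> U \<inter> V = {} \<and> parcs H = U \<times> V \<union> V \<times> U"
    if "H \<in> C" for H
    using bspec[OF K that] unfolding complete_bipartite_digraph_pair_def by (elim exE conjE) blast
  have same: "H = H'" if "H \<in> C" "H' \<in> C" "(v, w) \<in> parcs H" "(w, x) \<in> parcs H'" for H H' v w x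
  proof -
    have "w \<in> pverts H \<inter> pverts H'" using bip[OF that(1)] bip[OF that(2)] that(3,4) by blast
    thus ?thesis using disj that(1,2) unfolding pairwise_def by blast
  qed
  show ?closed
  proof (intro allI impI)
    fix v w x y assume "(v, w) \<in> parcs G" "(w, x) \<in> parcs G" "(x, y) \<in> parcs G"
    then obtain H where H: "H \<in> C" "(v, w) \<in> parcs H" "(w, x) \<in> parcs H" "(x, y) \<in> parcs H"
      unfolding arcs using same by blast
    obtain U V where "U \<inter> V = {}" "parcs H = U \<times> V \<union> V \<times> U"
      using bip[OF H(1)] by blast
    hence "(v, y) \<in> parcs H" using H(2-4) by blast
    thus "(v, y) \<in> parcs G" using H(1) arcs by blast
  qed
next
  assume closed: ?closed
  interpret pair_graph G by fact
  note sym = pair_graph_arcs_sym[OF G]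
  define V where "V v = parcs G `` {v}" for v
  \<comment> \<open>The explicit \<open>v\<close> matters only if \<open>v\<close> is isolated, when the component is \<open>K\<^bsub>1,0\<^esub>\<close>.\<close>
  define U where "U v = insert v (parcs G `` V v)" for v
  define K where "K v = \<lparr>pverts = U v \<union> V v, parcs = U v \<times> V v \<union> V v \<times> U v\<rparr>" for v
  have arc: "(x, y) \<in> parcs G" if "x \<in> U v" "y \<in> V v" for v x y
    using that closed sym unfolding U_def V_def by blast
  have disj: "U v \<inter> V v = {}" for v
    using arc pair_no_loops by fastforce
  have K_eq: "K x = K v" if x: "x \<in> U v \<union> V v" for v x
  proof (cases "x \<in> U v")
    case True
    have Vx: "V x = V v"
      using True closed sym unfolding U_def V_def by blast
    have "U x = U v"
    proof (cases "V v = {}")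
      case True
      thus ?thesis using Vx \<open>x \<in> U v\<close> by (auto simp: U_def)
    next
      case False
      hence "x \<in> parcs G `` V v" "v \<in> parcs G `` V v"
        using \<open>x \<in> U v\<close> sym by (auto simp: U_def V_def)
      thus ?thesis using Vx by (auto simp: U_def)
    qed
    thus ?thesis using Vx by (simp add: K_def)
  next
    case False
    hence "x \<in> V v" using x by blast
    hence "V x = U v" "U x = V v"
      using closed sym unfolding U_def V_def by blast+
    thus ?thesis by (auto simp: K_def)
  qed
  have fin: "finite (pverts (K v))" if "v \<in> pverts G" for v
  proof (rule finite_subset)
    show "pverts (K v) \<subseteq> pverts G" using that by (auto simp: K_def U_def V_def dest: wellformed')
  qed (rule pair_finite_verts)
  show "disjoint_union_of_complete_bipartite G"
    unfolding disjoint_union_of_complete_bipartite_def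
  proof (intro exI[of _ "K ` pverts G"] conjI)
    show "\<forall>H\<in>K ` pverts G. \<exists>p q. complete_bipartite_digraph p q (with_proj H)"
    proof
      fix H assume "H \<in> K ` pverts G"
      then obtain v where H: "v \<in> pverts G" "H = K v" by blast
      hence "complete_bipartite_digraph (card (U v)) (card (V v)) (with_proj H)"
        unfolding complete_bipartite_digraph_pair_def using fin disj
        by (intro conjI exI[of _ "U v"] exI[of _ "V v"]) (auto simp: K_def)
      thus "\<exists>p q. complete_bipartite_digraph p q (with_proj H)" by blast
    qed
    show "pairwise (\<lambda>H H'. pverts H \<inter> pverts H' = {}) (K ` pverts G)"
    proof (rule pairwiseI, elim imageE)
      fix H H' v v' assume H: "H = K v" "H' = K v'" "H \<noteq> H'"
      show "pverts H \<inter> pverts H' = {}"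
      proof (rule ccontr)
        assume "pverts H \<inter> pverts H' \<noteq> {}"
        then obtain x where "x \<in> U v \<union> V v" "x \<in> U v' \<union> V v'" unfolding H by (auto simp: K_def)
        thus False using K_eq H by metis
      qed
    qed
    show "pverts G = (\<Union>H\<in>K ` pverts G. pverts H)"
      by (auto simp: K_def U_def V_def dest: wellformed')
    show "parcs G = (\<Union>H\<in>K ` pverts G. parcs H)"
    proof (intro equalityI subsetI)
      fix a assume "a \<in> parcs G"
      thus "a \<in> (\<Union>H\<in>K ` pverts G. parcs H)"
        by (cases a) (auto simp: K_def U_def V_def dest: wellformed')
    next
      fix a assume "a \<in> (\<Union>H\<in>K ` pverts G. parcs H)"
      thus "a \<in> parcs G" by (auto simp: K_def intro: arc iffD1[OF sym arc])
    qed
  qed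
qed

text \<open>
  All neighbours of \<open>v\<close> have the same neighbourhood, hence \<open>f\<close> takes the same value at all of them,
  and the eigenvector equation at \<open>v\<close> reads \<open>r * f v = deg v * f w\<close>.  Together with the same equation at
  \<open>w\<close> this gives \<open>r\<^sup>2 = deg v * deg w\<close> unless \<open>f\<close> vanishes at \<open>v\<close> and \<open>w\<close>.
\<close>

lemma eigenvector_balanced_if_walks_close:
  fixes f :: "'a \<Rightarrow> real"
  assumes G: "pair_graph G"
    and closed: "\<And>v w x y. (v, w) \<in> parcs G \<Longrightarrow> (w, x) \<in> parcs G \<Longrightarrow> (x, y) \<in> parcs G
      \<Longrightarrow> (v, y) \<in> parcs G"
    and eigen: "\<And>v. v \<in> pverts G \<Longrightarrow> r * f v = (\<Sum>w\<in>parcs G `` {v}. f w)"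
    and r: "r \<noteq> 0" and arc: "(v, w) \<in> parcs G"
  shows "f v / sqrt (vertex_degree G v) = sgn r * (f w / sqrt (vertex_degree G w))"
proof -
  interpret pair_graph G by fact
  note sym = pair_graph_arcs_sym[OF G]
  define d where "d v = sqrt (vertex_degree G v)" for v
  have nbr: "r * f v = (d v)\<^sup>2 * f w" if arc: "(v, w) \<in> parcs G" for v w
  proof -
    have "f x = f w" if x: "x \<in> parcs G `` {v}" for x
    proof -
      have "x \<in> pverts G" "w \<in> pverts G" using x arc by (auto dest: wellformed')
      moreover have "parcs G `` {x} = parcs G `` {w}" using x arc closed sym by blast
      ultimately have "r * f x = r * f w" using eigen by metis
      thus ?thesis using r by simp
    qed
    hence "(\<Sum>x\<in>parcs G `` {v}. f x) = (\<Sum>x\<in>parcs G `` {v}. f w)"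
      by (rule sum.cong[OF refl])
    thus ?thesis using eigen[of v] arc
      by (auto simp: d_def vertex_degree_eq_card_Image[OF G] dest: wellformed')
  qed
  have at_v: "r * f v = (d v)\<^sup>2 * f w" and at_w: "r * f w = (d w)\<^sup>2 * f v"
    using nbr arc sym by blast+
  have d: "d v > 0" "d w > 0"
    using vertex_degree_pos[OF G] arc sym by (auto simp: d_def)
  have "f v / d v = sgn r * (f w / d w)"
  proof (cases "f v = 0")
    case True
    thus ?thesis using at_v d by simp
  next
    case False
    have "r * (r * f v) = (d v)\<^sup>2 * (r * f w)" unfolding at_v by (simp add: mult_ac)
    hence "r\<^sup>2 = (d v * d w)\<^sup>2"
      using False by (simp add: at_w power2_eq_square mult_ac)
    hence "\<bar>r\<bar> = d v * d w"
      using d by (metis abs_of_pos mult_pos_pos power2_eq_iff abs_minus_cancel)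
    hence r_eq: "r = sgn r * (d v * d w)" by (metis mult_sgn_abs)
    have "sgn r * (d v * d w) * f v = (d v)\<^sup>2 * f w" using at_v r_eq by simp
    hence "sgn r * (d w * f v) = d v * f w" using d by (simp add: power2_eq_square)
    hence "sgn r * (sgn r * (d w * f v)) = sgn r * (d v * f w)" by simp
    hence "d w * f v = sgn r * (d v * f w)"
      using r by (simp add: sgn_real_def split: if_splits)
    thus ?thesis using d by (simp add: field_simps)
  qed
  thus ?thesis by (simp add: d_def)
qed

section \<open>The case of equality\<close>

theorem theorem11:
  fixes G :: "'a pair_pre_digraph" and vs :: "'a list"
  assumes "pair_graph G"
    and "distinct vs" and "set vs = pverts G"
  shows "graph_energy vs G = 2 * randic_index G \<longleftrightarrow> disjoint_union_of_complete_bipartite G"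
proof -
  interpret pair_graph G by fact
  note G = assms(1) and sym = pair_graph_arcs_sym[OF assms(1)]
  let ?n = "length vs"
  define d where "d v = sqrt (vertex_degree G v)" for v
  obtain u l where
    unit: "\<And>k. k < ?n \<Longrightarrow> (\<Sum>v\<in>pverts G. (u k v)\<^sup>2) = 1" and
    eigen: "\<And>k v. k < ?n \<Longrightarrow> v \<in> pverts G \<Longrightarrow> l k * u k v = (\<Sum>w\<in>parcs G `` {v}. u k w)" and
    spectral: "\<And>v w. v \<in> pverts G \<Longrightarrow> w \<in> pverts G \<Longrightarrow>
      (\<Sum>k<?n. l k * (u k v * u k w)) = (if (v, w) \<in> parcs G then 1 else 0)" and
    energy: "graph_energy vs G = (\<Sum>k<?n. \<bar>l k\<bar>)"
    using adjacency_matrix_eigenbasis[OF assms] by blast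
  have d_pos: "d v > 0" if "(v, w) \<in> parcs G" for v w
    using vertex_degree_pos[OF G that] by (simp add: d_def)
  have gap: "graph_energy vs G - 2 * randic_index G =
      (\<Sum>k<?n. \<bar>l k\<bar> / 2 * (\<Sum>(v, w)\<in>parcs G. (u k v / d v - sgn (l k) * (u k w / d w))\<^sup>2))"
    unfolding d_def
  proof (rule energy_minus_twice_randic_index[OF G energy])
    show "(\<Sum>k<?n. l k * (u k v * u k w)) = 1" if "(v, w) \<in> parcs G" for v w
      using spectral[of v w] that by (auto dest: wellformed')
  qed (fact unit eigen)+
  have "graph_energy vs G = 2 * randic_index G \<longleftrightarrow>
      (\<forall>k<?n. \<bar>l k\<bar> / 2 * (\<Sum>(v, w)\<in>parcs G. (u k v / d v - sgn (l k) * (u k w / d w))\<^sup>2) = 0)"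
    using gap by (subst eq_iff_diff_eq_0, subst gap, subst sum_nonneg_eq_0_iff)
      (auto intro!: mult_nonneg_nonneg sum_nonneg)
  also have "\<dots> \<longleftrightarrow> (\<forall>k<?n. l k \<noteq> 0 \<longrightarrow>
      (\<forall>v w. (v, w) \<in> parcs G \<longrightarrow> u k v / d v = sgn (l k) * (u k w / d w)))"
    using pair_finite_arcs by (simp add: sum_nonneg_eq_0_iff case_prod_beta) fastforce
  finally have balanced_iff: "graph_energy vs G = 2 * randic_index G \<longleftrightarrow> \<dots>" .
  show ?thesis
    unfolding balanced_iff complete_bipartite_union_iff_walks_close[OF G]
  proof (intro iffI allI impI)
    fix v w x y
    assume balanced: "\<forall>k<?n. l k \<noteq> 0 \<longrightarrow>
        (\<forall>v w. (v, w) \<in> parcs G \<longrightarrow> u k v / d v = sgn (l k) * (u k w / d w))"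
      and arcs: "(v, w) \<in> parcs G" "(w, x) \<in> parcs G" "(x, y) \<in> parcs G"
    have V: "v \<in> pverts G" "x \<in> pverts G" "y \<in> pverts G" using arcs by (auto dest: wellformed')
    have d: "d v > 0" "d x > 0" using arcs d_pos by blast+
    have proportional: "l k * u k v = d v / d x * (l k * u k x)" if k: "k < ?n" for k
    proof (cases "l k = 0")
      case False
      hence "u k v / d v = sgn (l k) * (u k w / d w)" "u k x / d x = sgn (l k) * (u k w / d w)"
        using balanced k arcs sym by blast+
      hence "u k v / d v = u k x / d x" by simp
      thus ?thesis using d by (simp add: field_simps)
    qed simp
    \<comment> \<open>Rows \<open>v\<close> and \<open>x\<close> of the adjacency matrix are proportional, so the entry at \<open>(v, y)\<close> is
      nonzero along with the one at \<open>(x, y)\<close>.\<close>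
    have "(if (v, y) \<in> parcs G then 1 else 0) = (\<Sum>k<?n. (l k * u k v) * u k y)"
      using spectral[OF V(1,3)] by (simp add: mult.assoc)
    also have "\<dots> = (\<Sum>k<?n. d v / d x * (l k * (u k x * u k y)))"
      using proportional by (intro sum.cong) auto
    also have "\<dots> = d v / d x"
      unfolding sum_distrib_left[symmetric] using spectral[OF V(2,3)] arcs(3) by simp
    finally show "(v, y) \<in> parcs G" using d by (simp split: if_splits)
  next
    fix k v w
    assume closed: "\<forall>v w x y. (v, w) \<in> parcs G \<longrightarrow> (w, x) \<in> parcs G \<longrightarrow> (x, y) \<in> parcs G
        \<longrightarrow> (v, y) \<in> parcs G"
      and k: "k < ?n" "l k \<noteq> 0" and arc: "(v, w) \<in> parcs G"
    show "u k v / d v = sgn (l k) * (u k w / d w)"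
      unfolding d_def
      by (rule eigenvector_balanced_if_walks_close[OF G _ eigen[OF k(1)] k(2) arc])
        (use closed in blast)
  qed
qed

end
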